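(* Let $q,k_1,\dots,k_q$ be positive integers and let $\alpha_v,\lambda_v$ ($v=1,\dots,q$) be arbitrary real constants. For $v=1,\dots,q$ let $E_v$ be the Euler operator $$E_vu=x^2\frac{d^2u}{dx^2}+\alpha_v x\frac{du}{dx}+\lambda_v u,$$ and put $\phi_v=\frac12(-1+\alpha_v)$. Divide the index set $I=\{1,2,\dots,q\}$ into $$I_1=\{v\in I:\phi_v^2-\lambda_v>0\},\quad I_2=\{v\in I:\phi_v^2-\lambda_v<0\},\quad I_3=\{v\in I:\phi_v^2-\lambda_v=0\}.$$ Then the general solution of the iterated Euler equation $$\left(\prod_{v=1}^{q}E_v^{k_v}\right)u=\left(E_1^{k_1}E_2^{k_2}\cdots E_q^{k_q}\right)u=0$$ is $$\begin{aligned}u={}&\sum_{v\in I_1}\sum_{l=0}^{k_v-1}x^{-\phi_v}\left[A_{v,l}\,x^{\sqrt{\phi_v^2-\lambda_v}}+B_{v,l}\,x^{-\sqrt{\phi_v^2-\lambda_v}}\right](\ln x)^l\\&+\sum_{v\in I_2}\sum_{l=0}^{k_v-1}x^{-\phi_v}\left[C_{v,l}\cos\left(\sqrt{\lambda_v-\phi_v^2}\,\ln x\right)+D_{v,l}\sin\left(\sqrt{\lambda_v-\phi_v^2}\,\ln x\right)\right](\ln x)^l\\&+\sum_{v\in I_3}\sum_{l=0}^{2k_v-1}E_{v,l}\,x^{-\phi_v}(\ln x)^l,\end{aligned}$$ where $A_{v,l},B_{v,l},C_{v,l},D_{v,l},E_{v,l}$ are arbitrary real constants.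
   Context: Functions $u$ are real-valued functions of one real variable $x>0$. $E_v^{k}$ denotes the successive application of the operator $E_v$, i.e. $E_v^{k}u=E_v(E_v^{k-1}u)$, and the product of operators denotes composition. The constants $E_{v,l}$ (two indices) are not to be confused with the operators $E_v$. "General solution" means that the displayed functions, as the constants range over all real values, are exactly the (sufficiently differentiable) solutions of the equation.
   Formalization: That every solution has the displayed form is stated only when no two polynomials r(r-1)+α_v r+λ_v with different v share a complex root (else false: E_1=E_2, α=1, λ=0, u=(ln x)^2); that every displayed function is a solution is stated for arbitrary constants. *)

theory Defs
  imports "HOL-Analysis.Analysis"
begin

(* Functions of x > 0 are modelled as total functions real => real; only their values on
   {0<..} are ever constrained.  Since deriv u x depends only on u near x, the values of
   euler_op on {0<..} do not depend on how u is extended to x <= 0. *)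

definition euler_op :: "real \<Rightarrow> real \<Rightarrow> (real \<Rightarrow> real) \<Rightarrow> real \<Rightarrow> real" where
  "euler_op a c u = (\<lambda>x. x\<^sup>2 * deriv (deriv u) x + a * x * deriv u x + c * u x)"

(* The composition E_1^{k_1} o E_2^{k_2} o ... o E_q^{k_q}, in this order. *)
definition iterated_euler_op ::
  "nat \<Rightarrow> (nat \<Rightarrow> nat) \<Rightarrow> (nat \<Rightarrow> real) \<Rightarrow> (nat \<Rightarrow> real) \<Rightarrow> (real \<Rightarrow> real) \<Rightarrow> real \<Rightarrow> real" where
  "iterated_euler_op q k \<alpha> lam =
     foldr (\<lambda>v F. (euler_op (\<alpha> v) (lam v) ^^ k v) \<circ> F) [1..<Suc q] id"

definition times_differentiable_pos :: "nat \<Rightarrow> (real \<Rightarrow> real) \<Rightarrow> bool" where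
  "times_differentiable_pos n u \<longleftrightarrow>
     (\<forall>j<n. \<forall>x>0. (deriv ^^ j) u differentiable at x)"

(* The order of the equation is twice the sum of the k v. *)
definition iterated_euler_solution ::
  "nat \<Rightarrow> (nat \<Rightarrow> nat) \<Rightarrow> (nat \<Rightarrow> real) \<Rightarrow> (nat \<Rightarrow> real) \<Rightarrow> (real \<Rightarrow> real) \<Rightarrow> bool" where
  "iterated_euler_solution q k \<alpha> lam u \<longleftrightarrow>
     times_differentiable_pos (2 * (\<Sum>v\<in>{1..q}. k v)) u \<and>
     (\<forall>x>0. iterated_euler_op q k \<alpha> lam u x = 0)"

definition phi :: "(nat \<Rightarrow> real) \<Rightarrow> nat \<Rightarrow> real" where
  "phi \<alpha> v = 1/2 * (- 1 + \<alpha> v)"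

definition I1 :: "nat \<Rightarrow> (nat \<Rightarrow> real) \<Rightarrow> (nat \<Rightarrow> real) \<Rightarrow> nat set" where
  "I1 q \<alpha> lam = {v \<in> {1..q}. (phi \<alpha> v)\<^sup>2 - lam v > 0}"

definition I2 :: "nat \<Rightarrow> (nat \<Rightarrow> real) \<Rightarrow> (nat \<Rightarrow> real) \<Rightarrow> nat set" where
  "I2 q \<alpha> lam = {v \<in> {1..q}. (phi \<alpha> v)\<^sup>2 - lam v < 0}"

definition I3 :: "nat \<Rightarrow> (nat \<Rightarrow> real) \<Rightarrow> (nat \<Rightarrow> real) \<Rightarrow> nat set" where
  "I3 q \<alpha> lam = {v \<in> {1..q}. (phi \<alpha> v)\<^sup>2 - lam v = 0}"

definition euler_general_expr ::
  "nat \<Rightarrow> (nat \<Rightarrow> nat) \<Rightarrow> (nat \<Rightarrow> real) \<Rightarrow> (nat \<Rightarrow> real) \<Rightarrow>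
   (nat \<Rightarrow> nat \<Rightarrow> real) \<Rightarrow> (nat \<Rightarrow> nat \<Rightarrow> real) \<Rightarrow> (nat \<Rightarrow> nat \<Rightarrow> real) \<Rightarrow>
   (nat \<Rightarrow> nat \<Rightarrow> real) \<Rightarrow> (nat \<Rightarrow> nat \<Rightarrow> real) \<Rightarrow> real \<Rightarrow> real" where
  "euler_general_expr q k \<alpha> lam A B C D E x =
     (\<Sum>v\<in>I1 q \<alpha> lam. \<Sum>l<k v.
        x powr (- phi \<alpha> v) *
        (A v l * x powr sqrt ((phi \<alpha> v)\<^sup>2 - lam v) +
         B v l * x powr (- sqrt ((phi \<alpha> v)\<^sup>2 - lam v))) * (ln x) ^ l) +
     (\<Sum>v\<in>I2 q \<alpha> lam. \<Sum>l<k v.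
        x powr (- phi \<alpha> v) *
        (C v l * cos (sqrt (lam v - (phi \<alpha> v)\<^sup>2) * ln x) +
         D v l * sin (sqrt (lam v - (phi \<alpha> v)\<^sup>2) * ln x)) * (ln x) ^ l) +
     (\<Sum>v\<in>I3 q \<alpha> lam. \<Sum>l<2 * k v.
        E v l * x powr (- phi \<alpha> v) * (ln x) ^ l)"

definition of_displayed_form ::
  "nat \<Rightarrow> (nat \<Rightarrow> nat) \<Rightarrow> (nat \<Rightarrow> real) \<Rightarrow> (nat \<Rightarrow> real) \<Rightarrow> (real \<Rightarrow> real) \<Rightarrow> bool" where
  "of_displayed_form q k \<alpha> lam u \<longleftrightarrow>
     (\<exists>A B C D E. \<forall>x>0. u x = euler_general_expr q k \<alpha> lam A B C D E x)"

(* E_v maps x^r to (r (r - 1) + a r + c) x^r.  If two of these quadratics, for different v,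
   share a root, the roots of the whole equation have higher multiplicity than the k v
   account for and further powers of ln x occur: for E_1 u = E_2 u = x^2 u'' + x u', the
   function (ln x)^2 solves E_1 (E_2 u) = 0, but the displayed form with k_1 = k_2 = 1
   only contains 1 and ln x.  The complex roots must be excluded as well. *)
definition no_common_indicial_root :: "nat \<Rightarrow> (nat \<Rightarrow> real) \<Rightarrow> (nat \<Rightarrow> real) \<Rightarrow> bool" where
  "no_common_indicial_root q \<alpha> lam \<longleftrightarrow>
     (\<forall>v\<in>{1..q}. \<forall>w\<in>{1..q}. v \<noteq> w \<longrightarrow>
        \<not> (\<exists>r::complex. r * (r - 1) + of_real (\<alpha> v) * r + of_real (lam v) = 0 \<and>
                       r * (r - 1) + of_real (\<alpha> w) * r + of_real (lam w) = 0))"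

end

theory Submission
  imports Defs
begin

text \<open>Substituting \<open>x = exp t\<close> turns each Euler operator into \<open>(D - s) (D - r)\<close>, where \<open>D = d/dt\<close>
  and \<open>r\<close>, \<open>s\<close> are its complex indicial roots, so the iterated equation becomes a chain of
  first-order linear equations that are solved one after the other. Each one preserves the span of the
  functions \<open>t ^ l * exp (r * t)\<close> and raises the multiplicity of its own root by one. Without a common
  root the multiplicities are those of the displayed form, and taking real parts gives the real
  solutions.\<close>

section \<open>Differentiability to finite order on the positive half-line\<close>

lemma times_differentiable_pos_0 [simp]: "times_differentiable_pos 0 u"
  by (simp add: times_differentiable_pos_def)

text \<open>Peeling off the innermost derivative lets inductions on \<open>n\<close> generalise over
  the function and pass from \<open>u\<close> to \<open>deriv u\<close>.\<close>

lemma times_differentiable_pos_Suc: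
  "times_differentiable_pos (Suc n) u \<longleftrightarrow>
     (\<forall>x>0. u differentiable at x) \<and> times_differentiable_pos n (deriv u)"
  unfolding times_differentiable_pos_def
  by (simp add: All_less_Suc2 funpow_Suc_right del: funpow.simps(2))

lemma times_differentiable_pos_mono:
  "times_differentiable_pos n u \<Longrightarrow> m \<le> n \<Longrightarrow> times_differentiable_pos m u"
  by (auto simp: times_differentiable_pos_def)

lemma has_field_derivative_cong_pos:
  fixes u v :: "real \<Rightarrow> real"
  assumes "(u has_field_derivative d) (at x)" "\<And>y. y > 0 \<Longrightarrow> u y = v y" "x > 0"
  shows "(v has_field_derivative d) (at x)"
  using has_field_derivative_transform_within_open[of u d x "{0<..}" v] assms by auto

lemma real_differentiable_iff_DERIV_deriv:
  fixes u :: "real \<Rightarrow> real"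
  shows "u differentiable at x \<longleftrightarrow> (u has_field_derivative deriv u x) (at x)"
  using DERIV_deriv_iff_real_differentiable by metis

lemma times_differentiable_pos_cong:
  assumes "times_differentiable_pos n u" "\<And>x. x > 0 \<Longrightarrow> u x = v x"
  shows "times_differentiable_pos n v"
  using assms
proof (induction n arbitrary: u v)
  case (Suc n)
  have d: "(v has_field_derivative deriv u x) (at x)" if "x > 0" for x
    using Suc.prems that
    by (auto simp: times_differentiable_pos_Suc real_differentiable_iff_DERIV_deriv
        intro: has_field_derivative_cong_pos)
  then have "times_differentiable_pos n (deriv v)"
    using Suc.IH[of "deriv u" "deriv v"] Suc.prems DERIV_imp_deriv
    by (metis times_differentiable_pos_Suc)
  with d show ?case
    by (auto simp: times_differentiable_pos_Suc real_differentiable_def)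
qed simp

text \<open>Introduction rule with an explicit derivative \<open>d\<close>: it agrees with
  \<open>deriv u\<close> on the positive half-line, and nothing else is constrained.\<close>

lemma times_differentiable_pos_SucI:
  assumes "\<And>x. x > 0 \<Longrightarrow> (u has_field_derivative d x) (at x)" "times_differentiable_pos n d"
  shows "times_differentiable_pos (Suc n) u"
proof -
  have "times_differentiable_pos n (deriv u)"
    using assms by (auto intro!: times_differentiable_pos_cong[of n d] DERIV_imp_deriv[symmetric])
  then show ?thesis
    using assms(1) by (auto simp: times_differentiable_pos_Suc real_differentiable_def)
qed

lemma times_differentiable_pos_const: "times_differentiable_pos n (\<lambda>x. c)"
  by (induction n arbitrary: c) (auto intro!: times_differentiable_pos_SucI derivative_eq_intros)

lemma times_differentiable_pos_ident: "times_differentiable_pos n (\<lambda>x. x)"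
proof (cases n)
  case (Suc m)
  then show ?thesis
    using times_differentiable_pos_const[of m 1]
    by (auto intro!: times_differentiable_pos_SucI derivative_eq_intros)
qed simp

lemma times_differentiable_pos_add:
  "times_differentiable_pos n f \<Longrightarrow> times_differentiable_pos n g \<Longrightarrow>
     times_differentiable_pos n (\<lambda>x. f x + g x)"
proof (induction n arbitrary: f g)
  case (Suc n)
  then show ?case
    by (intro times_differentiable_pos_SucI[where d = "\<lambda>x. deriv f x + deriv g x"] Suc.IH)
      (auto simp: times_differentiable_pos_Suc real_differentiable_iff_DERIV_deriv
        intro!: derivative_eq_intros)
qed simp

lemma times_differentiable_pos_mult:
  "times_differentiable_pos n f \<Longrightarrow> times_differentiable_pos n g \<Longrightarrow>
     times_differentiable_pos n (\<lambda>x. f x * g x)"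
proof (induction n arbitrary: f g)
  case (Suc n)
  \<comment> \<open>The product rule leaves one factor undifferentiated in each term, so the factors
    themselves are needed at order \<open>n\<close>.\<close>
  have "times_differentiable_pos n f" "times_differentiable_pos n g"
    using Suc.prems by (auto elim: times_differentiable_pos_mono)
  with Suc show ?case
    by (intro times_differentiable_pos_SucI[where d = "\<lambda>x. deriv f x * g x + f x * deriv g x"]
        times_differentiable_pos_add Suc.IH)
      (auto simp: times_differentiable_pos_Suc real_differentiable_iff_DERIV_deriv
        intro!: derivative_eq_intros)
qed simp

lemma times_differentiable_pos_power:
  "times_differentiable_pos n f \<Longrightarrow> times_differentiable_pos n (\<lambda>x. f x ^ l)"
  by (induction l) (auto intro: times_differentiable_pos_const times_differentiable_pos_mult)

lemma times_differentiable_pos_sum: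
  "(\<And>i. i \<in> S \<Longrightarrow> times_differentiable_pos n (f i)) \<Longrightarrow>
     times_differentiable_pos n (\<lambda>x. \<Sum>i\<in>S. f i x)"
  by (induction S rule: infinite_finite_induct)
    (auto intro: times_differentiable_pos_const times_differentiable_pos_add)

lemma times_differentiable_pos_powr: "times_differentiable_pos n (\<lambda>x. x powr a)"
proof (induction n arbitrary: a)
  case (Suc n)
  show ?case
    by (intro times_differentiable_pos_SucI[where d = "\<lambda>x. a * x powr (a - 1)"]
        times_differentiable_pos_mult times_differentiable_pos_const Suc)
      (rule has_real_derivative_powr)
qed simp

lemma times_differentiable_pos_ln: "times_differentiable_pos n ln"
proof (cases n)
  case (Suc m)
  show ?thesis unfolding Suc
    \<comment> \<open>Writing 1/x as a real power reduces the claim to the smoothness of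
      powers.\<close>
    by (intro times_differentiable_pos_SucI[where d = "\<lambda>x. x powr (-1)"]
        times_differentiable_pos_powr)
      (auto intro!: derivative_eq_intros simp: powr_minus divide_simps)
qed simp

text \<open>Each derivative contains the other function, hence one joint induction.\<close>

lemma times_differentiable_pos_cos_sin_ln:
  "times_differentiable_pos n (\<lambda>x. cos (c * ln x)) \<and> times_differentiable_pos n (\<lambda>x. sin (c * ln x))"
proof (induction n)
  case (Suc n)
  have "times_differentiable_pos (Suc n) (\<lambda>x. cos (c * ln x))"
    using Suc
    by (intro times_differentiable_pos_SucI[where d = "\<lambda>x. (- c) * sin (c * ln x) * x powr (-1)"]
        times_differentiable_pos_mult times_differentiable_pos_const times_differentiable_pos_powr)
      (auto intro!: derivative_eq_intros simp: powr_minus divide_simps)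
  moreover have "times_differentiable_pos (Suc n) (\<lambda>x. sin (c * ln x))"
    using Suc
    by (intro times_differentiable_pos_SucI[where d = "\<lambda>x. c * cos (c * ln x) * x powr (-1)"]
        times_differentiable_pos_mult times_differentiable_pos_const times_differentiable_pos_powr)
      (auto intro!: derivative_eq_intros simp: powr_minus divide_simps)
  ultimately show ?case by blast
qed simp

lemma times_differentiable_pos_euler_general_expr:
  "times_differentiable_pos n (euler_general_expr q k \<alpha> lam A B C D E)"
  unfolding euler_general_expr_def[abs_def]
  by (intro times_differentiable_pos_add times_differentiable_pos_sum times_differentiable_pos_mult
      times_differentiable_pos_power times_differentiable_pos_powr times_differentiable_pos_const
      times_differentiable_pos_ln times_differentiable_pos_cos_sin_ln[THEN conjunct1]
      times_differentiable_pos_cos_sin_ln[THEN conjunct2])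

lemma times_differentiable_pos_euler_op:
  assumes "times_differentiable_pos (Suc (Suc n)) u"
  shows "times_differentiable_pos n (euler_op a c u)"
proof -
  have "times_differentiable_pos n u" "times_differentiable_pos n (deriv u)"
    "times_differentiable_pos n (deriv (deriv u))"
    using assms times_differentiable_pos_mono[of "Suc (Suc n)" u n]
      times_differentiable_pos_mono[of "Suc n" "deriv u" n]
    by (auto simp: times_differentiable_pos_Suc)
  then show ?thesis
    unfolding euler_op_def
    by (intro times_differentiable_pos_add times_differentiable_pos_mult
        times_differentiable_pos_power times_differentiable_pos_ident times_differentiable_pos_const)
qed

section \<open>Substitution of the exponential and factorisation of one Euler operator\<close>

text \<open>The head of the list is the innermost factor: \<open>first_order_kernel [r, s]\<close> is the kernel of
  \<open>(D - s) (D - r)\<close>.\<close>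

primrec first_order_kernel :: "complex list \<Rightarrow> (real \<Rightarrow> complex) set" where
  "first_order_kernel [] = {\<lambda>t. 0}"
| "first_order_kernel (r # rs) =
     {w. \<exists>g\<in>first_order_kernel rs. \<forall>t. (w has_vector_derivative r * w t + g t) (at t)}"

text \<open>The substitution x = exp t. Values are complex so that first-order factors with nonreal
  roots can act on the result.\<close>

definition exp_pullback :: "(real \<Rightarrow> real) \<Rightarrow> real \<Rightarrow> complex" where
  "exp_pullback u t = of_real (u (exp t))"

text \<open>With D = d/dt, x u' pulls back to D w and x^2 u'' to (D^2 - D) w. The operator therefore
  becomes D^2 + (a - 1) D + c, which is (D - s) (D - r) by the two Vieta relations.\<close>

lemma exp_pullback_euler_op_iff:
  assumes u: "times_differentiable_pos (Suc (Suc n)) u"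
    and rs: "r + s = of_real (1 - a)" "r * s = of_real c"
  shows "exp_pullback u \<in> first_order_kernel (r # s # rs) \<longleftrightarrow>
    exp_pullback (euler_op a c u) \<in> first_order_kernel rs"
proof -
  define u' where "u' = deriv u"
  define u'' where "u'' = deriv u'"
  define w where "w = exp_pullback u"
  define w1 where "w1 t = complex_of_real (exp t * u' (exp t))" for t
  define h where "h = exp_pullback (euler_op a c u)"
  have du: "(u has_field_derivative u' x) (at x)" "(u' has_field_derivative u'' x) (at x)"
    if "x > 0" for x
    using u that unfolding u''_def u'_def
    by (auto simp: times_differentiable_pos_Suc real_differentiable_iff_DERIV_deriv)
  have dw: "(w has_vector_derivative w1 t) (at t)" for t
  proof -
    have "((\<lambda>t. u (exp t)) has_field_derivative u' (exp t) * exp t) (at t)"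
      by (rule DERIV_chain2[OF du(1)]) (auto intro!: derivative_eq_intros)
    then have "((\<lambda>t. complex_of_real (u (exp t))) has_vector_derivative
        complex_of_real (u' (exp t) * exp t)) (at t)"
      by (intro has_vector_derivative_of_real) (simp add: has_real_derivative_iff_has_vector_derivative)
    then show ?thesis
      by (simp add: w_def exp_pullback_def[abs_def] w1_def mult.commute)
  qed
  have dw1: "(w1 has_vector_derivative of_real (exp t * u' (exp t) + (exp t)\<^sup>2 * u'' (exp t))) (at t)" for t
  proof -
    have "((\<lambda>t. u' (exp t)) has_field_derivative u'' (exp t) * exp t) (at t)"
      by (rule DERIV_chain2[OF du(2)]) (auto intro!: derivative_eq_intros)
    then have "((\<lambda>t. exp t * u' (exp t)) has_field_derivative
        exp t * u' (exp t) + (exp t)\<^sup>2 * u'' (exp t)) (at t)"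
      by (auto intro!: derivative_eq_intros simp: power2_eq_square)
    then show ?thesis
      unfolding w1_def[abs_def]
      by (intro has_vector_derivative_of_real) (simp add: has_real_derivative_iff_has_vector_derivative)
  qed
  \<comment> \<open>The intermediate function (D - r) w satisfies the outer equation with right-hand
    side \<open>h\<close>; this is where the Vieta relations enter.\<close>
  have dw2: "((\<lambda>t. w1 t - r * w t) has_vector_derivative s * (w1 t - r * w t) + h t) (at t)" for t
  proof -
    have "of_real (exp t * u' (exp t) + (exp t)\<^sup>2 * u'' (exp t)) - r * w1 t =
        s * (w1 t - r * w t) + h t"
    proof -
      have "s * (w1 t - r * w t) + h t + r * w1 t = (r + s) * w1 t - (r * s) * w t + h t"
        by (simp add: algebra_simps)
      also have "\<dots> = of_real (exp t * u' (exp t) + (exp t)\<^sup>2 * u'' (exp t))"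
        unfolding rs w1_def w_def h_def exp_pullback_def euler_op_def u''_def[symmetric] u'_def[symmetric]
        by (simp add: algebra_simps)
      finally show ?thesis by (simp add: algebra_simps)
    qed
    moreover have "((\<lambda>t. w1 t - r * w t) has_vector_derivative
        of_real (exp t * u' (exp t) + (exp t)\<^sup>2 * u'' (exp t)) - r * w1 t) (at t)"
      by (intro has_vector_derivative_diff has_vector_derivative_mult_right dw dw1)
    ultimately show ?thesis by simp
  qed
  show ?thesis
    unfolding w_def[symmetric] h_def[symmetric]
  proof
    assume "w \<in> first_order_kernel (r # s # rs)"
    then obtain g g2 where g: "\<And>t. (w has_vector_derivative r * w t + g t) (at t)"
      and g2: "g2 \<in> first_order_kernel rs" "\<And>t. (g has_vector_derivative s * g t + g2 t) (at t)"
      by auto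
    \<comment> \<open>Derivatives are unique, so the witnesses in the kernel can only be (D - r) w
      and then \<open>h\<close>.\<close>
    have "g = (\<lambda>t. w1 t - r * w t)"
      using vector_derivative_unique_at[OF g dw] by (auto simp: fun_eq_iff algebra_simps)
    then have "g2 = h"
      using vector_derivative_unique_at[OF g2(2)] dw2 by (fastforce simp: fun_eq_iff)
    with g2 show "h \<in> first_order_kernel rs" by simp
  next
    assume h: "h \<in> first_order_kernel rs"
    have "(\<lambda>t. w1 t - r * w t) \<in> first_order_kernel (s # rs)"
      using dw2 h by auto
    then show "w \<in> first_order_kernel (r # s # rs)"
      using dw by (auto intro!: bexI[of _ "\<lambda>t. w1 t - r * w t"] simp del: first_order_kernel.simps
          simp: first_order_kernel.simps(2)[of r])
  qed
qed

text \<open>Each application consumes two orders of differentiability and one block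
  \<open>[r, s]\<close> at the front of the list; \<open>m\<close> counts the orders left for later
  operators.\<close>

lemma exp_pullback_euler_op_funpow:
  assumes "times_differentiable_pos (2 * n + m) u"
    and "r + s = of_real (1 - a)" "r * s = of_real c"
  shows "times_differentiable_pos m ((euler_op a c ^^ n) u) \<and>
    (exp_pullback u \<in> first_order_kernel (concat (replicate n [r, s]) @ rs) \<longleftrightarrow>
     exp_pullback ((euler_op a c ^^ n) u) \<in> first_order_kernel rs)"
  using assms(1)
proof (induction n arbitrary: u)
  case (Suc n)
  have u: "times_differentiable_pos (Suc (Suc (2 * n + m))) u"
    using Suc.prems by simp
  show ?case
    using Suc.IH[OF times_differentiable_pos_euler_op[OF u]]
      exp_pullback_euler_op_iff[OF u assms(2,3)]
    by (simp add: funpow_Suc_right del: funpow.simps(2) first_order_kernel.simps)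
qed simp

section \<open>Indicial roots and the iterated operator\<close>

text \<open>The complex square root treats all three signs of the discriminant at once;
  \<open>b\<close> selects the sign in front of it.\<close>

definition indicial_root :: "(nat \<Rightarrow> real) \<Rightarrow> (nat \<Rightarrow> real) \<Rightarrow> bool \<Rightarrow> nat \<Rightarrow> complex" where
  "indicial_root \<alpha> lam b v = - of_real (phi \<alpha> v) +
     (if b then 1 else - 1) * csqrt (of_real ((phi \<alpha> v)\<^sup>2 - lam v))"

text \<open>The reversal is due to composition: the last operator acts first, and the head of the
  list is the innermost factor.\<close>

definition indicial_list ::
  "(nat \<Rightarrow> nat) \<Rightarrow> (nat \<Rightarrow> real) \<Rightarrow> (nat \<Rightarrow> real) \<Rightarrow> nat list \<Rightarrow> complex list" where
  "indicial_list k \<alpha> lam vs = concat (map (\<lambda>v. concat (replicate (k v)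
     [indicial_root \<alpha> lam True v, indicial_root \<alpha> lam False v])) (rev vs))"

lemma indicial_root_sum_prod:
  "indicial_root \<alpha> lam True v + indicial_root \<alpha> lam False v = of_real (1 - \<alpha> v)"
  "indicial_root \<alpha> lam True v * indicial_root \<alpha> lam False v = of_real (lam v)"
proof -
  have "csqrt z * csqrt z = z" for z
    using power2_csqrt[of z] by (simp add: power2_eq_square)
  then show "indicial_root \<alpha> lam True v * indicial_root \<alpha> lam False v = of_real (lam v)"
    by (simp add: indicial_root_def algebra_simps power2_eq_square)
qed (simp add: indicial_root_def phi_def)

text \<open>Eliminating \<open>\<alpha> v\<close> and \<open>lam v\<close> by the Vieta relations
  turns the quadratic into a product of linear factors, one of which vanishes.\<close>

lemma indicial_root_eq_0:
  "indicial_root \<alpha> lam b v * (indicial_root \<alpha> lam b v - 1) +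
     of_real (\<alpha> v) * indicial_root \<alpha> lam b v + of_real (lam v) = 0"
proof -
  have "complex_of_real (\<alpha> v) = 1 - (indicial_root \<alpha> lam True v + indicial_root \<alpha> lam False v)"
    by (simp add: indicial_root_sum_prod)
  then show ?thesis
    unfolding indicial_root_sum_prod(2)[of \<alpha> lam v, symmetric]
    by (cases b) (simp_all only:, simp_all add: algebra_simps)
qed

lemma exp_pullback_iterated_euler:
  fixes \<alpha> lam :: "nat \<Rightarrow> real"
  assumes "times_differentiable_pos (2 * sum_list (map k vs) + m) u"
  defines "F \<equiv> foldr (\<lambda>v F. (euler_op (\<alpha> v) (lam v) ^^ k v) \<circ> F) vs id"
  shows "times_differentiable_pos m (F u) \<and>
    (exp_pullback u \<in> first_order_kernel (indicial_list k \<alpha> lam vs @ rs) \<longleftrightarrow>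
     exp_pullback (F u) \<in> first_order_kernel rs)"
  using assms(1) unfolding F_def
proof (induction vs arbitrary: m rs)
  case (Cons v vs)
  \<comment> \<open>The operator of \<open>v\<close> acts after those of \<open>vs\<close>, so they
    must leave \<open>2 * k v\<close> orders for it besides \<open>m\<close>.\<close>
  note IH = Cons.IH[of "2 * k v + m"]
  show ?case
    using IH exp_pullback_euler_op_funpow[OF conjunct1[OF IH] indicial_root_sum_prod, where rs = rs] Cons.prems
    by (simp add: indicial_list_def algebra_simps)
qed (simp add: indicial_list_def)

text \<open>The exponential maps onto the positive half-line, so a function vanishes there exactly
  when its pullback is zero, that is, lies in the kernel of the empty list.\<close>

lemma iterated_euler_solution_iff:
  assumes "times_differentiable_pos (2 * (\<Sum>v\<in>{1..q}. k v)) u"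
  shows "iterated_euler_solution q k \<alpha> lam u \<longleftrightarrow>
    exp_pullback u \<in> first_order_kernel (indicial_list k \<alpha> lam [1..<Suc q])"
proof -
  have *: "sum_list (map k [1..<Suc q]) = (\<Sum>v\<in>{1..q}. k v)"
    by (simp only: interv_sum_list_conv_sum_set_nat set_upt atLeastLessThanSuc_atLeastAtMost)
  have "exp_pullback v \<in> first_order_kernel [] \<longleftrightarrow> (\<forall>x>0. v x = 0)" for v
  proof
    assume "exp_pullback v \<in> first_order_kernel []"
    then have "v (exp t) = 0" for t by (auto simp: exp_pullback_def fun_eq_iff)
    then show "\<forall>x>0. v x = 0" by (metis exp_ln)
  qed (auto simp: exp_pullback_def)
  then show ?thesis
    using exp_pullback_iterated_euler[where k = k and u = u and vs = "[1..<Suc q]" and m = 0 and rs = "[]"] assms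
    unfolding iterated_euler_solution_def iterated_euler_op_def * by (simp del: upt_Suc)
qed

section \<open>Exponential monomials as solutions\<close>

definition exp_monomial :: "nat \<Rightarrow> complex \<Rightarrow> real \<Rightarrow> complex" where
  "exp_monomial l r t = of_real t ^ l * exp (r * of_real t)"

text \<open>The product rule for an entire function, restricted to the real line. At
  \<open>l = 0\<close> the zero coefficient cancels the truncated \<open>l - 1\<close>.\<close>

lemma has_vector_derivative_exp_monomial:
  "(exp_monomial l r has_vector_derivative
     of_nat l * exp_monomial (l - 1) r t + r * exp_monomial l r t) (at t)"
proof -
  have "((\<lambda>z. z ^ l * exp (r * z)) has_field_derivative
      of_nat l * (of_real t ^ (l - 1) * exp (r * of_real t)) + r * (of_real t ^ l * exp (r * of_real t)))
      (at (complex_of_real t))"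
    by (auto intro!: derivative_eq_intros simp: algebra_simps)
  then show ?thesis
    unfolding exp_monomial_def[abs_def]
    by (rule has_vector_derivative_real_field)
qed

lemma zero_in_first_order_kernel: "(\<lambda>t. 0) \<in> first_order_kernel rs"
  by (induction rs) (auto intro!: bexI[of _ "\<lambda>t. 0"])

lemma add_in_first_order_kernel:
  "f \<in> first_order_kernel rs \<Longrightarrow> g \<in> first_order_kernel rs \<Longrightarrow>
     (\<lambda>t. f t + g t) \<in> first_order_kernel rs"
proof (induction rs arbitrary: f g)
  case (Cons r rs)
  then obtain f1 g1 where
    "f1 \<in> first_order_kernel rs" "\<And>t. (f has_vector_derivative r * f t + f1 t) (at t)"
    "g1 \<in> first_order_kernel rs" "\<And>t. (g has_vector_derivative r * g t + g1 t) (at t)"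
    by auto
  then show ?case
    by (auto intro!: bexI[of _ "\<lambda>t. f1 t + g1 t"] derivative_eq_intros Cons.IH simp: algebra_simps)
qed simp

lemma scale_in_first_order_kernel:
  "f \<in> first_order_kernel rs \<Longrightarrow> (\<lambda>t. c * f t) \<in> first_order_kernel rs"
proof (induction rs arbitrary: f)
  case (Cons r rs)
  then obtain f1 where
    "f1 \<in> first_order_kernel rs" "\<And>t. (f has_vector_derivative r * f t + f1 t) (at t)"
    by auto
  then show ?case
    by (auto intro!: bexI[of _ "\<lambda>t. c * f1 t"] derivative_eq_intros Cons.IH simp: algebra_simps)
qed simp

lemma sum_in_first_order_kernel:
  "(\<And>i. i \<in> S \<Longrightarrow> f i \<in> first_order_kernel rs) \<Longrightarrow>
     (\<lambda>t. \<Sum>i\<in>S. f i t) \<in> first_order_kernel rs"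
  by (induction S rule: infinite_finite_induct)
    (auto intro: zero_in_first_order_kernel add_in_first_order_kernel)

text \<open>D - s sends t^l exp(r t) to l t^(l-1) exp(r t) + (r - s) t^l exp(r t). If s = r, the
  degree drops along with the multiplicity left in the tail; otherwise the tail has the same
  multiplicity of r.\<close>

lemma exp_monomial_in_first_order_kernel:
  "l < count_list rs r \<Longrightarrow> exp_monomial l r \<in> first_order_kernel rs"
proof (induction rs arbitrary: l)
  case (Cons s rs)
  define g where "g t = of_nat l * exp_monomial (l - 1) r t + (r - s) * exp_monomial l r t" for t
  have "(\<lambda>t. of_nat l * exp_monomial (l - 1) r t) \<in> first_order_kernel rs"
    using Cons zero_in_first_order_kernel[of rs]
    by (cases l) (auto intro!: scale_in_first_order_kernel Cons.IH split: if_splits)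
  moreover have "(\<lambda>t. (r - s) * exp_monomial l r t) \<in> first_order_kernel rs"
    using Cons zero_in_first_order_kernel[of rs]
    by (cases "r = s") (auto intro!: scale_in_first_order_kernel Cons.IH)
  ultimately have "g \<in> first_order_kernel rs"
    unfolding g_def[abs_def] by (rule add_in_first_order_kernel)
  moreover have "(exp_monomial l r has_vector_derivative s * exp_monomial l r t + g t) (at t)" for t
    using has_vector_derivative_exp_monomial[of l r t] by (simp add: g_def algebra_simps)
  ultimately show ?case by auto
qed simp

section \<open>Solving the first-order chain inside the span of exponential monomials\<close>

text \<open>An inductive set, so that claims about the span follow term by term without indexing a
  family of coefficients.\<close>

inductive_set exp_monomial_span :: "complex list \<Rightarrow> (real \<Rightarrow> complex) set" for rs where
  zero: "(\<lambda>t. 0) \<in> exp_monomial_span rs"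
| add_monomial: "f \<in> exp_monomial_span rs \<Longrightarrow> l < count_list rs r \<Longrightarrow>
    (\<lambda>t. f t + c * exp_monomial l r t) \<in> exp_monomial_span rs"

lemma monomial_in_exp_monomial_span:
  "l < count_list rs r \<Longrightarrow> (\<lambda>t. c * exp_monomial l r t) \<in> exp_monomial_span rs"
  using add_monomial[OF zero, of l rs r c] by simp

lemma add_in_exp_monomial_span:
  assumes "g \<in> exp_monomial_span rs" "f \<in> exp_monomial_span rs"
  shows "(\<lambda>t. f t + g t) \<in> exp_monomial_span rs"
  using assms(1)
proof induction
  case (add_monomial g l r c)
  show ?case
    using exp_monomial_span.add_monomial[OF add_monomial.IH add_monomial.hyps(2), of c]
    by (simp add: add.assoc)
qed (use assms(2) in simp)

lemma scale_in_exp_monomial_span: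
  "f \<in> exp_monomial_span rs \<Longrightarrow> (\<lambda>t. d * f t) \<in> exp_monomial_span rs"
proof (induction rule: exp_monomial_span.induct)
  case (add_monomial g l r c)
  show ?case
    using exp_monomial_span.add_monomial[OF add_monomial.IH add_monomial.hyps(2), of "d * c"]
    by (simp add: algebra_simps)
qed (use zero in simp)

lemma ex_particular_solution_exp_monomial:
  "l < count_list rs s \<Longrightarrow> \<exists>w\<in>exp_monomial_span (r # rs).
     \<forall>t. (w has_vector_derivative r * w t + exp_monomial l s t) (at t)"
proof (cases "s = r")
  case True
  assume l: "l < count_list rs s"
  \<comment> \<open>Resonance: integrating t^l raises the degree by one, and the additional
    \<open>r\<close> at the head of the list admits that degree.\<close>
  define w where "w t = 1 / of_nat (Suc l) * exp_monomial (Suc l) r t" for t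
  have "w \<in> exp_monomial_span (r # rs)"
    unfolding w_def[abs_def] using l True by (intro monomial_in_exp_monomial_span) auto
  moreover have "(w has_vector_derivative r * w t + exp_monomial l s t) (at t)" for t
  proof -
    have "(w has_vector_derivative 1 / of_nat (Suc l) *
        (of_nat (Suc l) * exp_monomial l r t + r * exp_monomial (Suc l) r t)) (at t)"
      unfolding w_def[abs_def]
      using has_vector_derivative_exp_monomial[of "Suc l" r t]
      by (intro has_vector_derivative_mult_right) simp
    also have "1 / of_nat (Suc l) *
        (of_nat (Suc l) * exp_monomial l r t + r * exp_monomial (Suc l) r t) = r * w t + exp_monomial l s t"
      unfolding w_def True by (simp add: field_simps del: of_nat_Suc)
    finally show ?thesis .
  qed
  ultimately show ?thesis by blast
next
  case False
  assume "l < count_list rs s"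
  then show ?thesis
  proof (induction l)
    case 0
    define w where "w t = 1 / (s - r) * exp_monomial 0 s t" for t
    have "w \<in> exp_monomial_span (r # rs)"
      unfolding w_def[abs_def] using 0 by (intro monomial_in_exp_monomial_span) auto
    moreover have "(w has_vector_derivative r * w t + exp_monomial 0 s t) (at t)" for t
    proof -
      have "(w has_vector_derivative 1 / (s - r) * (s * exp_monomial 0 s t)) (at t)"
        unfolding w_def[abs_def]
        using has_vector_derivative_exp_monomial[of 0 s t]
        by (intro has_vector_derivative_mult_right) simp
      also have "1 / (s - r) * (s * exp_monomial 0 s t) = r * w t + exp_monomial 0 s t"
        unfolding w_def using False by (simp add: field_simps)
      finally show ?thesis .
    qed
    ultimately show ?case by blast
  next
    case (Suc l)
    then obtain v where v: "v \<in> exp_monomial_span (r # rs)"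
      "\<And>t. (v has_vector_derivative r * v t + exp_monomial l s t) (at t)" by auto
    \<comment> \<open>D - r sends the monomial of degree l + 1 to (s - r) times itself plus l + 1
      times the monomial of degree l. Subtracting (l + 1) v removes the lower term, and dividing by
      s - r normalises.\<close>
    define w where
      "w t = - of_nat (Suc l) / (s - r) * v t + 1 / (s - r) * exp_monomial (Suc l) s t" for t
    have "w \<in> exp_monomial_span (r # rs)"
      unfolding w_def[abs_def] using Suc.prems
      by (intro exp_monomial_span.add_monomial scale_in_exp_monomial_span v) auto
    moreover have "(w has_vector_derivative r * w t + exp_monomial (Suc l) s t) (at t)" for t
    proof -
      have "(w has_vector_derivative - of_nat (Suc l) / (s - r) * (r * v t + exp_monomial l s t) +
          1 / (s - r) * (of_nat (Suc l) * exp_monomial l s t + s * exp_monomial (Suc l) s t)) (at t)"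
        unfolding w_def[abs_def]
        using has_vector_derivative_exp_monomial[of "Suc l" s t] v(2)[of t]
        by (intro has_vector_derivative_add has_vector_derivative_mult_right) simp_all
      also have "- of_nat (Suc l) / (s - r) * (r * v t + exp_monomial l s t) +
          1 / (s - r) * (of_nat (Suc l) * exp_monomial l s t + s * exp_monomial (Suc l) s t) =
          r * w t + exp_monomial (Suc l) s t"
        unfolding w_def using False by (simp add: divide_simps del: of_nat_Suc) (simp add: algebra_simps)
      finally show ?thesis .
    qed
    ultimately show ?case by blast
  qed
qed

lemma ex_particular_solution:
  assumes "g \<in> exp_monomial_span rs"
  shows "\<exists>w\<in>exp_monomial_span (r # rs). \<forall>t. (w has_vector_derivative r * w t + g t) (at t)"
  using assms
proof induction
  case zero
  then show ?case using exp_monomial_span.zero[of "r # rs"]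
    by (auto intro!: bexI[of _ "\<lambda>t. 0"])
next
  case (add_monomial g l s c)
  then obtain w where w: "w \<in> exp_monomial_span (r # rs)"
    "\<And>t. (w has_vector_derivative r * w t + g t) (at t)" by auto
  obtain v where v: "v \<in> exp_monomial_span (r # rs)"
    "\<And>t. (v has_vector_derivative r * v t + exp_monomial l s t) (at t)"
    using ex_particular_solution_exp_monomial[OF add_monomial.hyps(2)] by blast
  have "(\<lambda>t. w t + c * v t) \<in> exp_monomial_span (r # rs)"
    by (intro add_in_exp_monomial_span scale_in_exp_monomial_span w v)
  moreover have "((\<lambda>t. w t + c * v t) has_vector_derivative
      r * (w t + c * v t) + (g t + c * exp_monomial l s t)) (at t)" for t
    using w(2)[of t] v(2)[of t] by (auto intro!: derivative_eq_intros simp: algebra_simps)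
  ultimately show ?case by blast
qed

text \<open>Multiplication by the integrating factor exp(-r t) gives a function with zero
  derivative, hence a constant.\<close>

lemma homogeneous_first_order_solution:
  fixes w :: "real \<Rightarrow> complex"
  assumes "\<And>t. (w has_vector_derivative r * w t) (at t)"
  shows "\<exists>c. w = (\<lambda>t. c * exp_monomial 0 r t)"
proof -
  have "((\<lambda>t. w t * exp_monomial 0 (- r) t) has_vector_derivative 0) (at t)" for t
    using has_vector_derivative_mult[OF assms[of t] has_vector_derivative_exp_monomial[of 0 "- r" t]]
    by (simp add: algebra_simps)
  then obtain c where c: "\<And>t. w t * exp_monomial 0 (- r) t = c"
    using has_vector_derivative_zero_constant[of UNIV "\<lambda>t. w t * exp_monomial 0 (- r) t"] by auto
  have "w t = c * exp_monomial 0 r t" for t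
    using c[of t] by (simp add: exp_monomial_def exp_minus field_simps)
  then show ?thesis by blast
qed

lemma first_order_kernel_subset_span: "first_order_kernel rs \<subseteq> exp_monomial_span rs"
proof (induction rs)
  case Nil
  then show ?case using exp_monomial_span.zero[of "[]"] by simp
next
  case (Cons r rs)
  show ?case
  proof
    fix w assume "w \<in> first_order_kernel (r # rs)"
    then obtain g where g: "g \<in> exp_monomial_span rs"
      "\<And>t. (w has_vector_derivative r * w t + g t) (at t)" using Cons by auto
    obtain v where v: "v \<in> exp_monomial_span (r # rs)"
      "\<And>t. (v has_vector_derivative r * v t + g t) (at t)"
      using ex_particular_solution[OF g(1)] by blast
    have "((\<lambda>t. w t - v t) has_vector_derivative r * (w t - v t)) (at t)" for t
      using has_vector_derivative_diff[OF g(2)[of t] v(2)[of t]] by (simp add: algebra_simps)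
    then obtain c where "(\<lambda>t. w t - v t) = (\<lambda>t. c * exp_monomial 0 r t)"
      using homogeneous_first_order_solution by blast
    then have "w = (\<lambda>t. v t + c * exp_monomial 0 r t)"
      by (auto simp: fun_eq_iff algebra_simps)
    then show "w \<in> exp_monomial_span (r # rs)"
      using exp_monomial_span.add_monomial[OF v(1), of 0 r c] by simp
  qed
qed

section \<open>Multiplicities of the indicial roots\<close>

lemma count_list_concat_replicate:
  "count_list (concat (replicate n xs)) r = n * count_list xs r"
  by (induction n) auto

text \<open>The inner count is 2 exactly when \<open>r\<close> is a double root for
  \<open>v\<close>, which is the source of the range \<open>2 * k v\<close> over
  \<open>I3\<close>.\<close>

lemma count_list_indicial_list:
  "count_list (indicial_list k \<alpha> lam vs) r =
    (\<Sum>v\<leftarrow>vs. k v * count_list [indicial_root \<alpha> lam True v, indicial_root \<alpha> lam False v] r)"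
  by (induction vs)
    (auto simp: indicial_list_def count_list_concat_replicate)

lemma count_list_indicial_list_upt:
  "count_list (indicial_list k \<alpha> lam [1..<Suc q]) r = (\<Sum>v\<in>{1..q}. k v *
     count_list [indicial_root \<alpha> lam True v, indicial_root \<alpha> lam False v] r)"
  unfolding count_list_indicial_list
  by (simp only: interv_sum_list_conv_sum_set_nat set_upt atLeastLessThanSuc_atLeastAtMost)

text \<open>One summand of a sum of naturals: other indices sharing the root can only raise its
  multiplicity.\<close>

lemma le_count_list_indicial_list:
  assumes "v \<in> {1..q}"
  shows "k v * count_list [indicial_root \<alpha> lam True v, indicial_root \<alpha> lam False v] r
    \<le> count_list (indicial_list k \<alpha> lam [1..<Suc q]) r"
  unfolding count_list_indicial_list_upt
  using assms by (intro member_le_sum[where f = "\<lambda>v. k v *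
     count_list [indicial_root \<alpha> lam True v, indicial_root \<alpha> lam False v] r"]) auto

text \<open>Without common roots a single index accounts for the whole multiplicity of
  \<open>r\<close>, so the bound on \<open>l\<close> is the one that this index imposes.\<close>

lemma less_count_list_indicial_listE:
  assumes "l < count_list (indicial_list k \<alpha> lam [1..<Suc q]) r"
    and "no_common_indicial_root q \<alpha> lam"
  obtains v b where "v \<in> {1..q}" "r = indicial_root \<alpha> lam b v"
    "l < k v * count_list [indicial_root \<alpha> lam True v, indicial_root \<alpha> lam False v] r"
proof -
  let ?c = "\<lambda>v. k v * count_list [indicial_root \<alpha> lam True v, indicial_root \<alpha> lam False v] r"
  have root: "\<exists>b. r = indicial_root \<alpha> lam b v" if "?c v \<noteq> 0" for v
    using that by (auto split: if_splits)
  have "\<exists>v\<in>{1..q}. ?c v \<noteq> 0"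
    using assms(1) unfolding count_list_indicial_list_upt by (metis (no_types, lifting) not_less_zero sum.neutral)
  then obtain v b where v: "v \<in> {1..q}" "r = indicial_root \<alpha> lam b v"
    using root by blast
  \<comment> \<open>Another contributing index would make \<open>r\<close> a common root of two
    indicial quadratics.\<close>
  have "?c w = 0" if "w \<in> {1..q} - {v}" for w
  proof (rule ccontr)
    assume "?c w \<noteq> 0"
    then obtain b' where "r = indicial_root \<alpha> lam b' w" using root by blast
    then have "r * (r - 1) + of_real (\<alpha> w) * r + of_real (lam w) = 0"
      using indicial_root_eq_0 by simp
    moreover have "r * (r - 1) + of_real (\<alpha> v) * r + of_real (lam v) = 0"
      using indicial_root_eq_0 v(2) by simp
    ultimately show False
      using assms(2) that v(1) unfolding no_common_indicial_root_def by auto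
  qed
  then have "sum ?c {1..q} = ?c v"
    using v(1) by (subst sum.mono_neutral_right[of _ "{v}"]) auto
  with assms(1) v that show ?thesis
    unfolding count_list_indicial_list_upt by metis
qed

section \<open>Passage between exponential monomials and the displayed form\<close>

lemma indicial_root_real:
  assumes "(phi \<alpha> v)\<^sup>2 - lam v \<ge> 0"
  shows "indicial_root \<alpha> lam b v =
    of_real (- phi \<alpha> v + (if b then 1 else - 1) * sqrt ((phi \<alpha> v)\<^sup>2 - lam v))"
  using csqrt_of_real_nonneg[of "of_real ((phi \<alpha> v)\<^sup>2 - lam v)"] assms
  by (simp add: indicial_root_def)

text \<open>The principal root of a negative real lies on the positive imaginary axis, so
  \<open>True\<close> picks the root in the upper half-plane.\<close>

lemma indicial_root_nonreal:
  assumes "(phi \<alpha> v)\<^sup>2 - lam v < 0"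
  shows "indicial_root \<alpha> lam b v =
    Complex (- phi \<alpha> v) ((if b then 1 else - 1) * sqrt (lam v - (phi \<alpha> v)\<^sup>2))"
  using csqrt_of_real_nonpos[of "of_real ((phi \<alpha> v)\<^sup>2 - lam v)"] assms
  by (simp add: indicial_root_def complex_eq_iff)

lemma exp_monomial_of_real: "exp_monomial l (of_real a) t = of_real (exp (a * t) * t ^ l)"
  by (simp add: exp_monomial_def mult.commute flip: exp_of_real)

lemma exp_monomial_Complex:
  "exp_monomial l (Complex a b) t = Complex (exp (a * t) * cos (b * t) * t ^ l) (exp (a * t) * sin (b * t) * t ^ l)"
  by (simp add: exp_monomial_def complex_eq_iff Re_exp Im_exp flip: of_real_power)

lemma of_displayed_form_in_kernel:
  assumes "of_displayed_form q k \<alpha> lam u"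
  shows "exp_pullback u \<in> first_order_kernel (indicial_list k \<alpha> lam [1..<Suc q])"
proof -
  let ?K = "first_order_kernel (indicial_list k \<alpha> lam [1..<Suc q])"
  let ?R = "indicial_root \<alpha> lam"
  have mon: "exp_monomial l (?R b v) \<in> ?K" if "v \<in> {1..q}" "l < k v" for v l b
    using le_count_list_indicial_list[OF that(1), of k \<alpha> lam "?R b v"] that(2)
    by (intro exp_monomial_in_first_order_kernel) (cases b; auto split: if_splits)
  \<comment> \<open>Over \<open>I3\<close> both roots coincide and are counted twice, which admits
    degrees up to \<open>2 * k v - 1\<close>.\<close>
  have mon3: "exp_monomial l (?R True v) \<in> ?K" if "v \<in> I3 q \<alpha> lam" "l < 2 * k v" for v l
    using le_count_list_indicial_list[of v q k \<alpha> lam "?R True v"] that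
    by (intro exp_monomial_in_first_order_kernel) (auto simp: I3_def indicial_root_real)
  obtain A B C D E where u: "\<And>x. x > 0 \<Longrightarrow> u x = euler_general_expr q k \<alpha> lam A B C D E x"
    using assms unfolding of_displayed_form_def by auto
  \<comment> \<open>The displayed expression at x = exp t as a complex combination of monomials. The
    coefficients (C - iD)/2 and (C + iD)/2 come from Euler's formulas for cosine and sine.\<close>
  define f where "f t =
     (\<Sum>v\<in>I1 q \<alpha> lam. \<Sum>l<k v. of_real (A v l) * exp_monomial l (?R True v) t +
        of_real (B v l) * exp_monomial l (?R False v) t) +
     (\<Sum>v\<in>I2 q \<alpha> lam. \<Sum>l<k v.
        (of_real (C v l) - \<i> * of_real (D v l)) / 2 * exp_monomial l (?R True v) t +
        (of_real (C v l) + \<i> * of_real (D v l)) / 2 * exp_monomial l (?R False v) t) +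
     (\<Sum>v\<in>I3 q \<alpha> lam. \<Sum>l<2 * k v. of_real (E v l) * exp_monomial l (?R True v) t)" for t
  have "f \<in> ?K"
    unfolding f_def[abs_def]
    by (intro add_in_first_order_kernel sum_in_first_order_kernel scale_in_first_order_kernel mon mon3)
      (auto simp: I1_def I2_def)
  moreover have "exp_pullback u = f"
  proof
    fix t
    have 1: "complex_of_real (exp t powr (- phi \<alpha> v) *
        (A v l * exp t powr sqrt ((phi \<alpha> v)\<^sup>2 - lam v) +
         B v l * exp t powr (- sqrt ((phi \<alpha> v)\<^sup>2 - lam v))) * (ln (exp t)) ^ l) =
        of_real (A v l) * exp_monomial l (?R True v) t + of_real (B v l) * exp_monomial l (?R False v) t"
      if "v \<in> I1 q \<alpha> lam" for v l
    proof -
      have ge: "(phi \<alpha> v)\<^sup>2 - lam v \<ge> 0" using that by (simp add: I1_def)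
      show ?thesis
        unfolding indicial_root_real[of \<alpha> v lam, OF ge] exp_monomial_of_real powr_def
        by (simp add: distrib_right exp_add[symmetric] algebra_simps
            flip: of_real_mult of_real_add of_real_power)
    qed
    have 2: "complex_of_real (exp t powr (- phi \<alpha> v) *
        (C v l * cos (sqrt (lam v - (phi \<alpha> v)\<^sup>2) * ln (exp t)) +
         D v l * sin (sqrt (lam v - (phi \<alpha> v)\<^sup>2) * ln (exp t))) * (ln (exp t)) ^ l) =
        (of_real (C v l) - \<i> * of_real (D v l)) / 2 * exp_monomial l (?R True v) t +
        (of_real (C v l) + \<i> * of_real (D v l)) / 2 * exp_monomial l (?R False v) t"
      if "v \<in> I2 q \<alpha> lam" for v l
    proof -
      have less: "(phi \<alpha> v)\<^sup>2 - lam v < 0" using that by (simp add: I2_def)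
      show ?thesis
        unfolding indicial_root_nonreal[of \<alpha> v lam, OF less] exp_monomial_Complex powr_def
        by (simp add: complex_eq_iff field_simps)
    qed
    have 3: "complex_of_real (E v l * exp t powr (- phi \<alpha> v) * (ln (exp t)) ^ l) =
        of_real (E v l) * exp_monomial l (?R True v) t" if "v \<in> I3 q \<alpha> lam" for v l
    proof -
      have eq: "(phi \<alpha> v)\<^sup>2 - lam v = 0" using that by (simp add: I3_def)
      show ?thesis
        unfolding indicial_root_real[of \<alpha> v lam, OF eq_refl[OF eq[symmetric]]] exp_monomial_of_real powr_def
        by (simp add: eq)
    qed
    have "exp_pullback u t = of_real (euler_general_expr q k \<alpha> lam A B C D E (exp t))"
      by (simp add: exp_pullback_def u)
    also have "\<dots> = f t"
      unfolding euler_general_expr_def f_def of_real_add of_real_sum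
      by (intro arg_cong2[of _ _ _ _ "(+)"] sum.cong refl) (simp_all only: 1 2 3)
    finally show "exp_pullback u t = f t" .
  qed
  ultimately show ?thesis by simp
qed

lemma of_displayed_form_add:
  assumes "of_displayed_form q k \<alpha> lam f" "of_displayed_form q k \<alpha> lam g"
  shows "of_displayed_form q k \<alpha> lam (\<lambda>x. f x + g x)"
proof -
  obtain A B C D E A' B' C' D' E' where
    "\<And>x. x > 0 \<Longrightarrow> f x = euler_general_expr q k \<alpha> lam A B C D E x"
    "\<And>x. x > 0 \<Longrightarrow> g x = euler_general_expr q k \<alpha> lam A' B' C' D' E' x"
    using assms unfolding of_displayed_form_def by blast
  then have "\<forall>x>0. f x + g x = euler_general_expr q k \<alpha> lam
     (\<lambda>v l. A v l + A' v l) (\<lambda>v l. B v l + B' v l) (\<lambda>v l. C v l + C' v l)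
     (\<lambda>v l. D v l + D' v l) (\<lambda>v l. E v l + E' v l) x"
    by (simp add: euler_general_expr_def algebra_simps sum.distrib)
  then show ?thesis
    unfolding of_displayed_form_def by blast
qed

lemma sum_sum_single:
  fixes f :: "'a \<Rightarrow> nat \<Rightarrow> 'b :: comm_monoid_add"
  assumes "finite S" "\<And>w m. w \<noteq> v \<or> m \<noteq> l \<Longrightarrow> f w m = 0"
  shows "(\<Sum>w\<in>S. \<Sum>m<n w. f w m) = (if v \<in> S \<and> l < n v then f v l else 0)"
proof -
  have "(\<Sum>m<n w. f w m) = (if w = v then if l < n v then f v l else 0 else 0)" for w
  proof (cases "w = v \<and> l < n v")
    case True
    then have "(\<Sum>m<n v. f v m) = sum (f v) {l}"
      using assms(2) by (intro sum.mono_neutral_right) auto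
    with True show ?thesis by simp
  next
    case False
    then show ?thesis using assms(2) by (force intro!: sum.neutral)
  qed
  then show ?thesis using assms(1) by (simp add: sum.delta)
qed

text \<open>All coefficients vanish except at the pair \<open>(v, l)\<close>. As \<open>I1\<close>,
  \<open>I2\<close> and \<open>I3\<close> are disjoint, at most one of the three terms
  survives.\<close>

lemma euler_general_expr_single:
  defines "single \<equiv> \<lambda>v l (a::real) w m. if w = v \<and> m = l then a else 0"
  shows "euler_general_expr q k \<alpha> lam (single v l a) (single v l b) (single v l c) (single v l d)
      (single v l e) x =
    (if v \<in> I1 q \<alpha> lam \<and> l < k v then x powr (- phi \<alpha> v) *
        (a * x powr sqrt ((phi \<alpha> v)\<^sup>2 - lam v) + b * x powr (- sqrt ((phi \<alpha> v)\<^sup>2 - lam v))) * (ln x) ^ l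
     else 0) +
    (if v \<in> I2 q \<alpha> lam \<and> l < k v then x powr (- phi \<alpha> v) *
        (c * cos (sqrt (lam v - (phi \<alpha> v)\<^sup>2) * ln x) + d * sin (sqrt (lam v - (phi \<alpha> v)\<^sup>2) * ln x)) * (ln x) ^ l
     else 0) +
    (if v \<in> I3 q \<alpha> lam \<and> l < 2 * k v then e * x powr (- phi \<alpha> v) * (ln x) ^ l else 0)"
proof -
  have "finite (I1 q \<alpha> lam)" "finite (I2 q \<alpha> lam)" "finite (I3 q \<alpha> lam)"
    by (auto simp: I1_def I2_def I3_def)
  then show ?thesis
    unfolding euler_general_expr_def
    by (subst (1 2 3) sum_sum_single[where v = v and l = l]) (auto simp: single_def)
qed

text \<open>The owner \<open>v\<close> of the root lies in exactly one of the three index sets, and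
  in each case the real part is a single displayed term with explicit coefficients.\<close>

lemma of_displayed_form_exp_monomial:
  assumes l: "l < count_list (indicial_list k \<alpha> lam [1..<Suc q]) r"
    and "no_common_indicial_root q \<alpha> lam"
  shows "of_displayed_form q k \<alpha> lam (\<lambda>x. Re (c * exp_monomial l r (ln x)))"
proof -
  obtain v b where v: "v \<in> {1..q}" and r: "r = indicial_root \<alpha> lam b v"
    and l: "l < k v * count_list [indicial_root \<alpha> lam True v, indicial_root \<alpha> lam False v] r"
    using assms less_count_list_indicial_listE by metis
  define single where "single a w m = (if w = v \<and> m = l then a else 0)" for a :: real and w m
  define \<sigma> :: real where "\<sigma> = (if b then 1 else - 1)"
  note expr = euler_general_expr_single[of q k \<alpha> lam v l, folded single_def]
  consider "(phi \<alpha> v)\<^sup>2 - lam v > 0" | "(phi \<alpha> v)\<^sup>2 - lam v < 0" | "(phi \<alpha> v)\<^sup>2 - lam v = 0"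
    by linarith
  then show ?thesis
  proof cases
    case 1
    define s where "s = sqrt ((phi \<alpha> v)\<^sup>2 - lam v)"
    have "s > 0" using 1 by (simp add: s_def)
    have R: "indicial_root \<alpha> lam b' v = of_real (- phi \<alpha> v + (if b' then 1 else - 1) * s)" for b'
      using 1 indicial_root_real[of \<alpha> v lam b'] by (simp add: s_def)
    have mem: "v \<in> I1 q \<alpha> lam" "v \<notin> I2 q \<alpha> lam" "v \<notin> I3 q \<alpha> lam" using 1 v by (auto simp: I1_def I2_def I3_def)
    \<comment> \<open>Positivity of \<open>s\<close> keeps the two roots distinct, so the inner
      count is 1.\<close>
    have "l < k v" using l \<open>s > 0\<close> unfolding r R by (cases b) auto
    with mem have "\<forall>x>0. Re (c * exp_monomial l r (ln x)) = euler_general_expr q k \<alpha> lam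
        (single (if b then Re c else 0)) (single (if b then 0 else Re c)) (single 0) (single 0) (single 0) x"
      unfolding r R expr exp_monomial_of_real s_def[symmetric]
      by (cases b) (simp_all add: powr_def exp_add[symmetric] algebra_simps)
    then show ?thesis unfolding of_displayed_form_def by blast
  next
    case 2
    define s where "s = sqrt (lam v - (phi \<alpha> v)\<^sup>2)"
    have "s > 0" using 2 by (simp add: s_def)
    have R: "indicial_root \<alpha> lam b' v = Complex (- phi \<alpha> v) ((if b' then 1 else - 1) * s)" for b'
      using 2 indicial_root_nonreal[of \<alpha> v lam b'] by (simp add: s_def)
    have mem: "v \<notin> I1 q \<alpha> lam" "v \<in> I2 q \<alpha> lam" "v \<notin> I3 q \<alpha> lam" using 2 v by (auto simp: I1_def I2_def I3_def)
    have "l < k v" using l \<open>s > 0\<close> unfolding r R by (cases b) auto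
    \<comment> \<open>Up to the real factors, Re (c exp(i y)) = Re c cos y - Im c sin y; the
      conjugate root flips the sign of the sine term.\<close>
    with mem have "\<forall>x>0. Re (c * exp_monomial l r (ln x)) = euler_general_expr q k \<alpha> lam
        (single 0) (single 0) (single (Re c)) (single (if b then - Im c else Im c)) (single 0) x"
      unfolding r R expr exp_monomial_Complex s_def[symmetric]
      by (cases b) (simp_all add: powr_def algebra_simps)
    then show ?thesis unfolding of_displayed_form_def by blast
  next
    case 3
    have R: "indicial_root \<alpha> lam b' v = of_real (- phi \<alpha> v)" for b'
      using 3 indicial_root_real[of \<alpha> v lam b'] by simp
    have mem: "v \<notin> I1 q \<alpha> lam" "v \<notin> I2 q \<alpha> lam" "v \<in> I3 q \<alpha> lam" using 3 v by (auto simp: I1_def I2_def I3_def)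
    have "l < 2 * k v" using l unfolding r R by simp
    with mem have "\<forall>x>0. Re (c * exp_monomial l r (ln x)) = euler_general_expr q k \<alpha> lam
        (single 0) (single 0) (single 0) (single 0) (single (Re c)) x"
      unfolding r R expr exp_monomial_of_real by (simp add: powr_def)
    then show ?thesis unfolding of_displayed_form_def by blast
  qed
qed

lemma of_displayed_form_exp_monomial_span:
  assumes "w \<in> exp_monomial_span (indicial_list k \<alpha> lam [1..<Suc q])"
    and "no_common_indicial_root q \<alpha> lam"
  shows "of_displayed_form q k \<alpha> lam (\<lambda>x. Re (w (ln x)))"
  using assms(1)
proof induction
  case zero
  show ?case
    unfolding of_displayed_form_def
    by (intro exI[of _ "\<lambda>_ _. 0"]) (simp add: euler_general_expr_def)
next
  case (add_monomial f l r c)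
  then show ?case
    using of_displayed_form_add[OF add_monomial.IH of_displayed_form_exp_monomial[OF _ assms(2)]]
    by simp
qed

theorem theorem2:
  fixes q :: nat and k :: "nat \<Rightarrow> nat" and \<alpha> lam :: "nat \<Rightarrow> real"
  assumes "q > 0" and "\<And>v. v \<in> {1..q} \<Longrightarrow> k v > 0"
  shows "(\<forall>u. of_displayed_form q k \<alpha> lam u \<longrightarrow> iterated_euler_solution q k \<alpha> lam u) \<and>
         (no_common_indicial_root q \<alpha> lam \<longrightarrow>
            (\<forall>u. iterated_euler_solution q k \<alpha> lam u \<longleftrightarrow> of_displayed_form q k \<alpha> lam u))"
proof -
  have solution: "iterated_euler_solution q k \<alpha> lam u" if u: "of_displayed_form q k \<alpha> lam u" for u
  proof -
    obtain A B C D E where "\<And>x. x > 0 \<Longrightarrow> u x = euler_general_expr q k \<alpha> lam A B C D E x"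
      using u unfolding of_displayed_form_def by auto
    then have "times_differentiable_pos (2 * (\<Sum>v\<in>{1..q}. k v)) u"
      by (metis times_differentiable_pos_euler_general_expr times_differentiable_pos_cong)
    then show ?thesis
      using iterated_euler_solution_iff of_displayed_form_in_kernel[OF u] by blast
  qed
  moreover have "of_displayed_form q k \<alpha> lam u"
    if "no_common_indicial_root q \<alpha> lam" "iterated_euler_solution q k \<alpha> lam u" for u
  proof -
    have "exp_pullback u \<in> first_order_kernel (indicial_list k \<alpha> lam [1..<Suc q])"
      using that(2) iterated_euler_solution_iff unfolding iterated_euler_solution_def by blast
    \<comment> \<open>The pullback is real-valued, so taking its real part at t = ln x recovers
      \<open>u\<close> on the positive half-line.\<close>
    then have "of_displayed_form q k \<alpha> lam (\<lambda>x. Re (exp_pullback u (ln x)))"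
      using first_order_kernel_subset_span of_displayed_form_exp_monomial_span that(1) by blast
    then show ?thesis
      by (simp add: of_displayed_form_def exp_pullback_def)
  qed
  ultimately show ?thesis by blast
qed

end
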